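(* Let $G$ be a finite non-abelian $p$-group ($p$ a prime). Then the enhanced power graph $\mathcal{G}_e(G)$ satisfies the cone property if and only if $G$ is a generalized quaternion group.
   Context: For a group $G$, the enhanced power graph $\mathcal{G}_e(G)$ is the simple undirected graph with vertex set $G$ in which two distinct vertices $x,y$ are adjacent if there exists $z\in G$ with $x=z^m$ and $y=z^n$ for some $m,n\in\mathbb{N}$. $\mathcal{G}_e(G)$ satisfies the cone property if it has a cone vertex, i.e. a vertex other than the identity element that is adjacent to every other vertex. *)

theory Defs
  imports
    "HOL-Algebra.Generated_Groups"
    "HOL-Computational_Algebra.Primes"
    "Graph_Theory.Pair_Digraph"
begin

text \<open>A simple undirected graph is a loop-free symmetric digraph without parallel arcs, i.e. a
  \<^locale>\<open>pair_graph\<close>.  The exponents range over all natural numbers including 0; in a finite group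
  this gives the same graph as positive exponents.\<close>

definition enhanced_power_graph :: "('a, 'b) monoid_scheme \<Rightarrow> 'a pair_pre_digraph" where
  "enhanced_power_graph G =
     \<lparr> pverts = carrier G,
       parcs = {(x, y). x \<in> carrier G \<and> y \<in> carrier G \<and> x \<noteq> y \<and>
         (\<exists>z \<in> carrier G. \<exists>(m :: nat) (n :: nat). x = z [^]\<^bsub>G\<^esub> m \<and> y = z [^]\<^bsub>G\<^esub> n)} \<rparr>"

lemma pair_graph_enhanced_power_graph:
  assumes "finite (carrier G)"
  shows "pair_graph (enhanced_power_graph G)"
proof
  show "finite (parcs (enhanced_power_graph G))"
    by (rule finite_subset[of _ "carrier G \<times> carrier G"])
      (use assms in \<open>auto simp: enhanced_power_graph_def\<close>)
  show "symmetric (with_proj (enhanced_power_graph G))"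
    unfolding symmetric_def with_proj_simps
    by (auto simp: enhanced_power_graph_def sym_def)
qed (use assms in \<open>auto simp: enhanced_power_graph_def\<close>)

definition is_cone_vertex :: "('a, 'b) monoid_scheme \<Rightarrow> 'a \<Rightarrow> bool" where
  "is_cone_vertex G v \<longleftrightarrow>
     v \<in> pverts (enhanced_power_graph G) \<and> v \<noteq> \<one>\<^bsub>G\<^esub> \<and>
     (\<forall>u \<in> pverts (enhanced_power_graph G). u \<noteq> v \<longrightarrow> v \<rightarrow>\<^bsub>enhanced_power_graph G\<^esub> u)"

definition cone_property :: "('a, 'b) monoid_scheme \<Rightarrow> bool" where
  "cone_property G \<longleftrightarrow> (\<exists>v. is_cone_vertex G v)"

text \<open>The generalized quaternion group of order \<open>2\<^sup>n\<close>, \<open>n \<ge> 3\<close>, has the presentation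
  \<open>\<langle>x, y | x^(2^(n-1)) = 1, y^2 = x^(2^(n-2)), y^(-1) x y = x^(-1)\<rangle>\<close>.
  A group generated by two elements satisfying these relations is a quotient of the presented
  group, which has order \<open>2\<^sup>n\<close>; requiring the order to be \<open>2\<^sup>n\<close> makes the relations defining.\<close>

definition generalized_quaternion :: "('a, 'b) monoid_scheme \<Rightarrow> bool" where
  "generalized_quaternion G \<longleftrightarrow> group G \<and>
     (\<exists>n \<ge> 3. order G = 2 ^ n \<and>
       (\<exists>x \<in> carrier G. \<exists>y \<in> carrier G.
          generate G {x, y} = carrier G \<and>
          x [^]\<^bsub>G\<^esub> (2 ^ (n - 1) :: nat) = \<one>\<^bsub>G\<^esub> \<and>
          y [^]\<^bsub>G\<^esub> (2 :: nat) = x [^]\<^bsub>G\<^esub> (2 ^ (n - 2) :: nat) \<and>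
          inv\<^bsub>G\<^esub> y \<otimes>\<^bsub>G\<^esub> x \<otimes>\<^bsub>G\<^esub> y = inv\<^bsub>G\<^esub> x))"

end

theory Submission
  imports
    Defs
    "HOL-Algebra.Group_Action"
    "HOL-Number_Theory.Residues"
begin

text \<open>
  A cone vertex of a finite p-group forces the subgroup of order p to be unique, and then of two
  commuting elements one is always a power of the other.  Hence a normal cyclic subgroup
  \<open>A = \<langle>x\<rangle>\<close> of maximal order is its own centralizer: otherwise a fixed-point argument in \<open>G / A\<close>
  gives a larger normal cyclic subgroup.  If \<open>y \<notin> A\<close>, \<open>y\<^sup>p \<in> A\<close> and \<open>y x y\<^sup>-\<^sup>1 = x\<^sup>r\<close>, then
  \<open>(x\<^sup>j y)\<^sup>p = x\<^sup>j\<^sup>S y\<^sup>p\<close> with \<open>S = 1 + r + \<dots> + r\<^sup>p\<^sup>-\<^sup>1\<close>.  No such element may have order p, so \<open>p\<^sup>2\<close>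
  divides \<open>S\<close>; as \<open>r \<equiv> 1\<close> modulo p, this leaves only \<open>p = 2\<close> and \<open>r \<equiv> 3\<close> modulo 4.
  Then \<open>y\<^sup>2\<close> and \<open>(x y)\<^sup>2 = x\<^sup>1\<^sup>+\<^sup>r y\<^sup>2\<close> both equal the unique involution, so y inverts x.
  Since no square in \<open>G\<close> inverts x, \<open>A\<close> has index 2.
\<close>

section \<open>Powers and conjugation\<close>

context group
begin

abbreviation cyc :: "'a \<Rightarrow> 'a set" where
  "cyc x \<equiv> generate G {x}"

lemma cyc_subgroup: "x \<in> carrier G \<Longrightarrow> subgroup (cyc x) G"
  by (simp add: generate_is_subgroup)

lemma cyc_self: "x \<in> cyc x"
  by (simp add: generate.incl)

lemma cyc_closed: "x \<in> carrier G \<Longrightarrow> y \<in> cyc x \<Longrightarrow> y \<in> carrier G"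
  by (rule subgroup.mem_carrier[OF cyc_subgroup])

lemma cyc_pow_closed:
  assumes "x \<in> carrier G" "y \<in> cyc x"
  shows "y [^] (k::nat) \<in> cyc x"
  using subgroup_int_pow_closed[OF cyc_subgroup[OF assms(1)] assms(2), of "int k"]
  by (simp add: int_pow_int)

lemma cyc_mono:
  assumes "x \<in> carrier G" "y \<in> cyc x"
  shows "cyc y \<subseteq> cyc x"
  using generate_subgroup_incl[of "{y}", OF _ cyc_subgroup[OF assms(1)]] assms(2) by simp

lemma cyc_powI:
  assumes "x \<in> carrier G"
  shows "x [^] (k::nat) \<in> cyc x"
  by (rule cyc_pow_closed[OF assms cyc_self])

text \<open>Conjugation by \<open>g\<close> is a homomorphism, so the image of the generator
  decides. This reduces normality of \<open>cyc x\<close> to a condition on \<open>x\<close>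
  alone.\<close>

lemma cyc_conj:
  assumes "g \<in> carrier G" "x \<in> carrier G" "g \<otimes> x \<otimes> inv g \<in> cyc x" "h \<in> cyc x"
  shows "g \<otimes> h \<otimes> inv g \<in> cyc x"
proof -
  interpret S: subgroup "cyc x" G
    using assms by (intro cyc_subgroup)
  have "h \<in> generate G {x}" by fact
  then show ?thesis
  proof induction
    case one
    then show ?case using assms by simp
  next
    case (incl h)
    then show ?case using assms by simp
  next
    case (inv h)
    have "g \<otimes> inv x \<otimes> inv g = inv (g \<otimes> x \<otimes> inv g)"
      using assms by (simp add: inv_mult_group m_assoc)
    then show ?case using inv assms by simp
  next
    case (eng h1 h2)
    have "h1 \<in> carrier G" "h2 \<in> carrier G"
      using eng by auto
    then have "g \<otimes> (h1 \<otimes> h2) \<otimes> inv g = (g \<otimes> h1 \<otimes> inv g) \<otimes> (g \<otimes> h2 \<otimes> inv g)"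
      using assms by (simp add: m_assoc inv_solve_left)
    then show ?case using eng by simp
  qed
qed

lemma pow_cong:
  assumes "x \<in> carrier G" "[i = j] (mod ord x)"
  shows "x [^] (i::nat) = x [^] (j::nat)"
proof -
  have "int (ord x) dvd int j - int i"
    using assms(2) by (meson cong_iff_dvd_diff cong_int_iff cong_sym)
  then have "x [^] int i = x [^] int j"
    using int_pow_eq[OF assms(1)] by blast
  then show ?thesis by (simp add: int_pow_int)
qed

lemma pow_eq_imp_cong:
  assumes "x \<in> carrier G" "x [^] (i::nat) = x [^] (j::nat)"
  shows "[i = j] (mod ord x)"
proof -
  have "x [^] int i = x [^] int j"
    using assms(2) by (simp add: int_pow_int)
  then have "int (ord x) dvd int j - int i"
    using int_pow_eq[OF assms(1)] by blast
  then show ?thesis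
    by (meson cong_iff_dvd_diff cong_int_iff cong_sym)
qed

section \<open>Elements acting on a cyclic subgroup by a power map\<close>

text \<open>The relation \<open>y \<otimes> x = x [^] r \<otimes> y\<close> is conjugation of
  \<open>x\<close> by \<open>y\<close> written without inverses, so that all exponents stay natural
  numbers.\<close>

lemma twist_pow:
  fixes r k :: nat
  assumes "x \<in> carrier G" "y \<in> carrier G" "y \<otimes> x = x [^] r \<otimes> y"
  shows "y \<otimes> x [^] k = x [^] (r * k) \<otimes> y"
proof (induction k)
  case 0
  then show ?case using assms by simp
next
  case (Suc k)
  have "y \<otimes> x [^] Suc k = (y \<otimes> x [^] k) \<otimes> x"
    using assms by (simp add: m_assoc)
  also have "\<dots> = x [^] (r * k) \<otimes> (y \<otimes> x)"
    unfolding Suc using assms by (simp add: m_assoc)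
  also have "\<dots> = x [^] (r * k) \<otimes> x [^] r \<otimes> y"
    using assms by (simp add: m_assoc)
  also have "\<dots> = x [^] (r * Suc k) \<otimes> y"
    using assms by (simp add: nat_pow_mult add.commute)
  finally show ?case .
qed

lemma twist_pow_pow:
  fixes r n :: nat
  assumes "x \<in> carrier G" "y \<in> carrier G" "y \<otimes> x = x [^] r \<otimes> y"
  shows "y [^] n \<otimes> x = x [^] (r ^ n) \<otimes> y [^] n"
proof (induction n)
  case 0
  then show ?case using assms by simp
next
  case (Suc n)
  have "y [^] Suc n \<otimes> x = y [^] n \<otimes> x [^] r \<otimes> y"
    using assms by (simp add: m_assoc)
  also have "y [^] n \<otimes> x [^] r = x [^] (r ^ n * r) \<otimes> y [^] n"
    using assms Suc by (intro twist_pow) auto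
  finally show ?case using assms by (simp add: m_assoc mult.commute)
qed

text \<open>Moving every \<open>y\<close> to the right, the factor \<open>x [^] j\<close> in
  position \<open>i\<close>, counted from 0, is passed by \<open>i\<close> copies of
  \<open>y\<close> and ends up with exponent \<open>j * r ^ i\<close>.\<close>

lemma twist_mult_pow:
  fixes r j n :: nat
  assumes "x \<in> carrier G" "y \<in> carrier G" "y \<otimes> x = x [^] r \<otimes> y"
  shows "(x [^] j \<otimes> y) [^] n = x [^] (j * (\<Sum>i<n. r ^ i)) \<otimes> y [^] n"
proof (induction n)
  case 0
  then show ?case using assms by simp
next
  case (Suc n)
  let ?s = "\<Sum>i<n. r ^ i"
  have "(x [^] j \<otimes> y) [^] Suc n = (x [^] (j * ?s) \<otimes> y [^] n) \<otimes> (x [^] j \<otimes> y)"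
    using Suc assms by simp
  also have "\<dots> = x [^] (j * ?s) \<otimes> (y [^] n \<otimes> x [^] j) \<otimes> y"
    using assms by (simp add: m_assoc)
  also have "y [^] n \<otimes> x [^] j = x [^] (r ^ n * j) \<otimes> y [^] n"
    by (rule twist_pow) (use assms twist_pow_pow[OF assms] in auto)
  also have "x [^] (j * ?s) \<otimes> (x [^] (r ^ n * j) \<otimes> y [^] n) \<otimes> y
      = (x [^] (j * ?s) \<otimes> x [^] (r ^ n * j)) \<otimes> (y [^] n \<otimes> y)"
    using assms by (simp add: m_assoc)
  also have "x [^] (j * ?s) \<otimes> x [^] (r ^ n * j) = x [^] (j * (\<Sum>i<Suc n. r ^ i))"
    using assms by (simp add: nat_pow_mult algebra_simps)
  finally show ?case by simp
qed

end

section \<open>Finite p-groups\<close>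

locale finite_p_group = group +
  fixes p :: nat
  assumes prime_p: "prime p"
    and order_prime_power: "\<exists>k. order G = p ^ k"
begin

lemma finite_carrier: "finite (carrier G)"
proof -
  have "order G > 0"
    using order_prime_power prime_gt_0_nat[OF prime_p] by auto
  then show ?thesis using order_gt_0_iff_finite by simp
qed

section \<open>Subgroups of a cyclic p-group\<close>

lemma cyc_iff:
  assumes "x \<in> carrier G"
  shows "y \<in> cyc x \<longleftrightarrow> (\<exists>k::nat. y = x [^] k)"
  unfolding generate_pow_on_finite_carrier[OF finite_carrier assms] by simp

lemma cyc_involution:
  assumes "w \<in> carrier G" "w [^] (2::nat) = \<one>" "v \<in> cyc w"
  shows "v = \<one> \<or> v = w"
proof -
  obtain k :: nat where k: "v = w [^] k" using assms cyc_iff by blast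
  have "[k = k mod 2] (mod 2)" by (simp add: cong_def)
  then have "[k = k mod 2] (mod ord w)"
    by (rule cong_dvd_modulus_nat) (use assms pow_eq_id in simp)
  then have "v = w [^] (k mod 2)" unfolding k by (intro pow_cong assms)
  then show ?thesis using assms by (cases "even k") (simp_all add: odd_iff_mod_2_eq_one)
qed

lemma prime_power_dvd_order:
  assumes "d dvd order G"
  shows "\<exists>k. d = p ^ k"
proof -
  obtain n where "order G = p ^ n" using order_prime_power by blast
  then have "d dvd p ^ n" using assms by simp
  then show ?thesis using divides_primepow_nat[OF prime_p, of d n] by blast
qed

lemma ord_prime_power: "x \<in> carrier G \<Longrightarrow> \<exists>k. ord x = p ^ k"
  using ord_dvd_group_order prime_power_dvd_order by blast

lemma p_dvd_ord:
  assumes "x \<in> carrier G" "x \<noteq> \<one>"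
  shows "p dvd ord x"
proof -
  obtain k where k: "ord x = p ^ k" using ord_prime_power assms by blast
  then have "k \<noteq> 0" using assms ord_eq_1[of x] by (intro notI) simp
  then show ?thesis using k by simp
qed

text \<open>The order of \<open>x\<close> is a power of \<open>p\<close>, so \<open>k\<close> is
  invertible modulo it.\<close>

lemma mem_cyc_coprime_pow:
  assumes "x \<in> carrier G" "\<not> p dvd k"
  shows "x \<in> cyc (x [^] k)"
proof -
  obtain s where s: "ord x = p ^ s" using ord_prime_power assms by blast
  have "coprime k (p ^ s)"
    using assms(2) prime_p by (metis coprime_commute coprime_power_left_iff prime_imp_coprime)
  then obtain n where "[k * n = 1] (mod ord x)"
    using cong_solve_coprime_nat s by (metis One_nat_def)
  then have "x [^] (k * n) = x [^] (1::nat)"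
    using assms pow_cong by blast
  then have "x = (x [^] k) [^] n"
    using assms by (simp add: nat_pow_pow)
  then show ?thesis
    using cyc_powI[of "x [^] k" n] assms by simp
qed

text \<open>The subgroups of a cyclic p-group form a chain: by \<open>mem_cyc_coprime_pow\<close>
  only the power of \<open>p\<close> in an exponent matters, and powers of \<open>p\<close> divide
  one another.\<close>

lemma cyclic_comparable:
  assumes z: "z \<in> carrier G" and "a \<in> cyc z" "b \<in> cyc z"
  shows "a \<in> cyc b \<or> b \<in> cyc a"
proof -
  obtain i j :: nat where ij: "a = z [^] i" "b = z [^] j"
    using assms cyc_iff by blast
  have *: "z [^] l \<in> cyc (z [^] k)"
    if "k \<noteq> 0" "multiplicity p k \<le> multiplicity p l" "l \<noteq> 0" for k l :: nat
  proof -
    obtain u where u: "k = p ^ multiplicity p k * u" "\<not> p dvd u"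
      using multiplicity_decompose'[of k p] \<open>k \<noteq> 0\<close> not_prime_unit[of p] prime_p by metis
    let ?t = "z [^] (p ^ multiplicity p k)"
    have "p ^ multiplicity p k dvd l"
      using that(2) by (rule multiplicity_dvd')
    then obtain v where "l = p ^ multiplicity p k * v" by auto
    then have "z [^] l = ?t [^] v"
      using z by (simp add: nat_pow_pow)
    moreover have "?t \<in> cyc (?t [^] u)"
      using z u(2) by (intro mem_cyc_coprime_pow) auto
    moreover have "?t [^] u = z [^] k"
      using z u(1) by (simp add: nat_pow_pow)
    ultimately show ?thesis
      using z cyc_pow_closed[of "z [^] k" ?t v] by simp
  qed
  show ?thesis
  \<comment> \<open>\<open>multiplicity p 0\<close> is 0 by convention and says nothing about
    divisibility, so exponent 0 is treated apart.\<close>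
  proof (cases "i = 0 \<or> j = 0")
    case True
    then show ?thesis
      unfolding ij using z by (auto intro: generate.one)
  next
    case False
    then show ?thesis
      unfolding ij using *[of i j] *[of j i] by linarith
  qed
qed

text \<open>Elements of exponent \<open>p\<close> lie at the bottom of the chain: if instead
  \<open>b = a [^] k\<close>, then \<open>b \<noteq> \<one>\<close> makes \<open>k\<close> prime to
  \<open>p\<close>, and \<open>a\<close> is a power of \<open>b\<close> after all.\<close>

lemma mem_cyc_of_pow_p:
  assumes z: "z \<in> carrier G" and ab: "a \<in> cyc z" "b \<in> cyc z" and "a [^] p = \<one>" "b \<noteq> \<one>"
  shows "a \<in> cyc b"
proof (rule ccontr)
  assume "a \<notin> cyc b"
  have a: "a \<in> carrier G" using cyc_closed z ab by blast
  have "b \<in> cyc a"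
    using cyclic_comparable[OF z ab] \<open>a \<notin> cyc b\<close> by blast
  then obtain k :: nat where k: "b = a [^] k" using a cyc_iff by blast
  have "\<not> p dvd k"
  proof
    assume "p dvd k"
    then obtain l where "k = p * l" by auto
    then have "b = \<one>" using k a assms(4) by (simp flip: nat_pow_pow)
    then show False using assms by simp
  qed
  then show False
    using mem_cyc_coprime_pow[OF a] k \<open>a \<notin> cyc b\<close> by blast
qed

lemma exists_pow_order_p:
  assumes "x \<in> carrier G" "x \<noteq> \<one>"
  shows "\<exists>k::nat. x [^] k \<noteq> \<one> \<and> (x [^] k) [^] p = \<one>"
proof -
  obtain s where s: "ord x = p ^ s" using ord_prime_power assms by blast
  then have "s \<noteq> 0" using assms ord_eq_1 by (metis power_0)
  then obtain t where t: "s = Suc t" using not0_implies_Suc by blast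
  have "\<not> p ^ s dvd p ^ t"
    using t prime_gt_1_nat[OF prime_p] by (simp add: power_dvd_imp_le dvd_power_iff_le prime_ge_2_nat prime_p)
  then have "x [^] (p ^ t) \<noteq> \<one>"
    using assms s pow_eq_id by simp
  moreover have "(x [^] (p ^ t)) [^] p = \<one>"
    using assms s t pow_eq_id[of x "p ^ t * p"] by (simp add: nat_pow_pow mult.commute)
  ultimately show ?thesis by blast
qed

section \<open>Central elements from orbit counting\<close>

text \<open>Conjugation splits \<open>N - {\<one>}\<close> into orbits of p-power size. If none were
  a singleton, \<open>p\<close> would divide both \<open>card N - 1\<close> and
  \<open>card N\<close>.\<close>

lemma normal_meets_center:
  assumes N: "N \<lhd> G" and nontriv: "\<not> N \<subseteq> {\<one>}"
  shows "\<exists>c \<in> N. c \<noteq> \<one> \<and> (\<forall>g \<in> carrier G. g \<otimes> c = c \<otimes> g)"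
proof (rule ccontr)
  assume no_center: "\<not> ?thesis"
  interpret N: normal N G by fact
  define \<phi> where "\<phi> = (\<lambda>g. (\<lambda>h \<in> carrier G. g \<otimes> h \<otimes> (inv g)))"
  interpret action: group_action G "carrier G" \<phi>
    unfolding \<phi>_def by (rule action_by_conjugation)
  have mem_orbit: "y \<in> orbit G \<phi> c \<longleftrightarrow> (\<exists>g \<in> carrier G. y = g \<otimes> c \<otimes> inv g)" if "c \<in> carrier G" for c y
    using that by (auto simp: orbit_def \<phi>_def)
  define Orbs where "Orbs = orbit G \<phi> ` (N - {\<one>})"
  have finN: "finite N" using finite_carrier N.subset finite_subset by blast
  have sub: "orbit G \<phi> c \<subseteq> N - {\<one>}" if "c \<in> N - {\<one>}" for c
  proof
    fix y assume "y \<in> orbit G \<phi> c"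
    have c: "c \<in> carrier G" "c \<noteq> \<one>" "c \<in> N" using that by auto
    obtain g where g: "g \<in> carrier G" "y = g \<otimes> c \<otimes> inv g"
      using \<open>y \<in> orbit G \<phi> c\<close> c mem_orbit by blast
    then have "y \<in> N" using N.inv_op_closed2 c by blast
    moreover have "y \<noteq> \<one>"
    proof
      assume "y = \<one>"
      then have "g \<otimes> c = g" using g c inv_solve_right'[of "\<one>" "g \<otimes> c" g] by simp
      then show False using g c by simp
    qed
    ultimately show "y \<in> N - {\<one>}" by simp
  qed
  have union: "\<Union>Orbs = N - {\<one>}"
  proof
    show "\<Union>Orbs \<subseteq> N - {\<one>}" unfolding Orbs_def using sub by blast
    show "N - {\<one>} \<subseteq> \<Union>Orbs"
    proof
      fix c assume c: "c \<in> N - {\<one>}"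
      then have "c \<in> orbit G \<phi> c" by (intro action.orbit_refl) simp
      then show "c \<in> \<Union>Orbs" using c unfolding Orbs_def by blast
    qed
  qed
  have "p dvd card B" if B: "B \<in> Orbs" for B
  proof -
    obtain c where c: "c \<in> N" "c \<noteq> \<one>" "B = orbit G \<phi> c"
      using B unfolding Orbs_def by blast
    then have cG: "c \<in> carrier G" by simp
    have "card B dvd order G"
      using action.orbit_stabilizer_theorem[OF cG] c(3) by (metis dvd_triv_left)
    then obtain j where j: "card B = p ^ j" using prime_power_dvd_order by blast
    have "j \<noteq> 0"
    proof
      assume "j = 0"
      then have "is_singleton B" using j by (simp add: is_singleton_altdef)
      moreover have "c \<in> B" using c cG action.orbit_refl by blast
      ultimately have "B = {c}" by (metis is_singletonE singletonD)
      then have "g \<otimes> c = c \<otimes> g" if "g \<in> carrier G" for g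
        using mem_orbit[OF cG, of "g \<otimes> c \<otimes> inv g"] that c(3) cG
        by (metis inv_solve_right' m_closed singletonD)
      then show False using no_center c by blast
    qed
    then show ?thesis using j by simp
  qed
  then have dvd: "\<forall>B \<in> Orbs. p dvd card B" by blast
  have "Orbs \<subseteq> orbits G (carrier G) \<phi>"
    unfolding Orbs_def orbits_def using N.subset by blast
  then have disj: "\<forall>B1 \<in> Orbs. \<forall>B2 \<in> Orbs. B1 \<noteq> B2 \<longrightarrow> B1 \<inter> B2 = {}"
    using action.disjoint_union by (meson subsetD)
  have "finite (\<Union>Orbs)" using union finN by simp
  then have "p dvd card (\<Union>Orbs)" using dvd disj by (rule dvd_partition)
  then have "p dvd card N - 1"
    using union finN by simp
  moreover have "card N dvd order G"
    using lagrange[OF N.subgroup_axioms] by (metis dvd_triv_right)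
  then obtain j where j: "card N = p ^ j" using prime_power_dvd_order by blast
  have "j \<noteq> 0"
  proof
    assume "j = 0"
    then have "is_singleton N" using j by (simp add: is_singleton_altdef)
    then show False using nontriv N.one_closed by (metis is_singletonE singletonD subset_refl)
  qed
  then have "p dvd card N" using j by simp
  moreover have "card N \<ge> 1" using j prime_gt_0_nat[OF prime_p] by simp
  ultimately have "p dvd 1"
    by (metis dvd_diffD1)
  then show False using prime_p by auto
qed

lemma finite_p_group_Mod:
  assumes "N \<lhd> G"
  shows "finite_p_group (G Mod N) p"
proof -
  interpret N: normal N G by fact
  interpret Q: group "G Mod N" by (rule N.factorgroup_is_group)
  have "order (G Mod N) dvd order G"
    using lagrange[OF N.subgroup_axioms] by (metis FactGroup_def dvd_triv_left order_def partial_object.select_convs(1))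
  then show ?thesis
    using prime_power_dvd_order prime_p by unfold_locales auto
qed

text \<open>This is \<open>normal_meets_center\<close> for the image of \<open>C\<close> in
  \<open>G Mod A\<close>, pulled back to \<open>G\<close>: a central coset has a representative that
  commutes with everything up to a factor in \<open>A\<close>.\<close>

lemma normal_central_step:
  assumes A: "A \<lhd> G" and C: "C \<lhd> G" and "\<not> C \<subseteq> A"
  shows "\<exists>c \<in> C - A. \<forall>g \<in> carrier G. \<exists>a \<in> A. g \<otimes> c \<otimes> inv g = a \<otimes> c"
proof -
  interpret A: normal A G by fact
  interpret C: normal C G by fact
  interpret Q: finite_p_group "G Mod A" p by (rule finite_p_group_Mod) fact
  let ?q = "\<lambda>a. A #> a"
  have hom: "group_hom G (G Mod A) ?q"
    using A.r_coset_hom_Mod by unfold_locales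
  have "?q ` carrier G = carrier (G Mod A)"
    by (auto simp: FactGroup_def RCOSETS_def)
  then have "?q ` C \<lhd> G Mod A"
    using C.surj_hom_normal_subgroup[OF hom] by blast
  moreover have one: "\<one>\<^bsub>G Mod A\<^esub> = A" by (simp add: FactGroup_def)
  have in_A: "c \<in> A" if "c \<in> C" "?q c = A" for c
    using that coset_join1 A.subgroup_axioms by simp
  obtain d where "d \<in> C" "d \<notin> A" using \<open>\<not> C \<subseteq> A\<close> by blast
  then have "?q d \<in> ?q ` C" "?q d \<noteq> \<one>\<^bsub>G Mod A\<^esub>" using in_A one by auto
  then have "\<not> ?q ` C \<subseteq> {\<one>\<^bsub>G Mod A\<^esub>}" by blast
  ultimately have "\<exists>d \<in> ?q ` C. d \<noteq> \<one>\<^bsub>G Mod A\<^esub> \<and>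
      (\<forall>g \<in> carrier (G Mod A). g \<otimes>\<^bsub>G Mod A\<^esub> d = d \<otimes>\<^bsub>G Mod A\<^esub> g)"
    by (rule Q.normal_meets_center)
  then obtain c where c: "c \<in> C" "?q c \<noteq> A"
    and central: "\<And>g. g \<in> carrier (G Mod A) \<Longrightarrow> g \<otimes>\<^bsub>G Mod A\<^esub> ?q c = ?q c \<otimes>\<^bsub>G Mod A\<^esub> g"
    unfolding one by blast
  have cG: "c \<in> carrier G" using c by simp
  have "\<exists>a \<in> A. g \<otimes> c \<otimes> inv g = a \<otimes> c" if g: "g \<in> carrier G" for g
  proof -
    have "?q g <#> ?q c = ?q c <#> ?q g"
      using central[of "?q g"] g by (simp add: FactGroup_def RCOSETS_def) blast
    then have "?q (g \<otimes> c) = ?q (c \<otimes> g)"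
      using g cG by (simp add: A.rcos_sum)
    then have "g \<otimes> c \<in> ?q (c \<otimes> g)"
      using g cG rcos_self[of "g \<otimes> c"] A.subgroup_axioms by auto
    then obtain a where a: "a \<in> A" "g \<otimes> c = a \<otimes> (c \<otimes> g)"
      unfolding r_coset_def by auto
    then have "g \<otimes> c \<otimes> inv g = a \<otimes> c"
      using g cG by (simp add: m_assoc inv_solve_right')
    then show ?thesis using a by blast
  qed
  moreover have "c \<notin> A"
    using c A.rcos_const by blast
  ultimately show ?thesis using c by blast
qed

end

section \<open>p-groups with a unique subgroup of order p\<close>

text \<open>Uniqueness of the subgroup of order \<open>p\<close>, put in terms of elements so that
  no such subgroup has to be named.\<close>

locale p_group_unique_min = finite_p_group +
  assumes order_p_mem_cyc:
    "\<And>u v. u \<in> carrier G \<Longrightarrow> v \<in> carrier G \<Longrightarrow> u [^] p = \<one> \<Longrightarrow> v \<noteq> \<one> \<Longrightarrow> u \<in> cyc v"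
begin

section \<open>Commuting elements and a self-centralizing cyclic subgroup\<close>

text \<open>Otherwise let \<open>c\<close> be the last of the iterated p-th powers of
  \<open>a\<close> outside \<open>cyc b\<close>, with \<open>c [^] p = b [^] k\<close>. If
  \<open>p\<close> divides \<open>k\<close>, then \<open>c\<close> times a suitable power of
  \<open>b\<close> has exponent \<open>p\<close>, hence lies in \<open>cyc b\<close>, and so does
  \<open>c\<close>. If not, \<open>b\<close> is a power of \<open>c [^] p\<close> and thus of
  \<open>a\<close>.\<close>

lemma commuting_comparable:
  assumes a: "a \<in> carrier G" and b: "b \<in> carrier G" and comm: "a \<otimes> b = b \<otimes> a"
  shows "a \<in> cyc b \<or> b \<in> cyc a"
proof (rule ccontr)
  assume contra: "\<not> ?thesis"
  interpret B: subgroup "cyc b" G using b by (rule cyc_subgroup)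
  have "b \<noteq> \<one>"
    using contra generate.one[of G "{a}"] by blast
  obtain n where "ord a = p ^ n" using ord_prime_power a by blast
  then have "a [^] (p ^ n) = \<one>" using a pow_eq_id by simp
  then have "a [^] (p ^ n) \<in> cyc b" using generate.one[of G "{b}"] by argo
  then obtain m where m: "a [^] (p ^ m) \<in> cyc b" "\<And>i. i < m \<Longrightarrow> a [^] (p ^ i) \<notin> cyc b"
    using exists_least_iff[of "\<lambda>m. a [^] (p ^ m) \<in> cyc b"] by blast
  have "m \<noteq> 0"
  proof
    assume "m = 0"
    then show False using m(1) a contra by simp
  qed
  then obtain l where l: "m = Suc l" using not0_implies_Suc by blast
  define c where "c = a [^] (p ^ l)"
  have c: "c \<in> carrier G" "c \<notin> cyc b" "c \<in> cyc a"
    using m(2)[of l] l a cyc_powI unfolding c_def by auto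
  have "c [^] p \<in> cyc b"
    using m(1) l a unfolding c_def by (simp add: nat_pow_pow mult.commute)
  then obtain k :: nat where k: "c [^] p = b [^] k" using cyc_iff b by blast
  show False
  proof (cases "p dvd k")
    case True
    then obtain i where i: "k = i * p" by (metis dvdE mult.commute)
    define d where "d = inv (b [^] i)"
    have d: "d \<in> cyc b"
      unfolding d_def using b by (intro B.m_inv_closed cyc_powI)
    then have dG: "d \<in> carrier G" by simp
    have "c \<otimes> b [^] i = b [^] i \<otimes> c"
      unfolding c_def using a b comm
      by (intro group_commutes_pow sym[OF group_commutes_pow]) auto
    then have "b [^] i \<otimes> (c \<otimes> d) = c"
      unfolding d_def using b c(1) by (simp add: inv_solve_right' flip: m_assoc)
    then have "c \<otimes> d = d \<otimes> c"
      unfolding d_def using b c(1) dG inv_solve_left[of "c \<otimes> d" "b [^] i" c] d_def by simp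
    then have "(c \<otimes> d) [^] p = c [^] p \<otimes> d [^] p"
      using c(1) dG by (rule pow_mult_distrib)
    also have "\<dots> = \<one>"
      unfolding d_def k i using b by (simp add: nat_pow_inv nat_pow_pow)
    finally have "c \<otimes> d \<in> cyc b"
      using order_p_mem_cyc[of "c \<otimes> d" b] c(1) dG b \<open>b \<noteq> \<one>\<close> by simp
    then have "c \<otimes> d \<otimes> inv d \<in> cyc b"
      using B.m_closed B.m_inv_closed[OF d] by blast
    then show False using c dG by (simp add: m_assoc)
  next
    case False
    then have "b \<in> cyc (c [^] p)" using b k mem_cyc_coprime_pow by simp
    moreover have "c [^] p \<in> cyc a" using a c(3) by (intro cyc_pow_closed)
    ultimately show False using contra cyc_mono a by blast
  qed
qed

text \<open>Take \<open>cyc x\<close> of maximal size among normal cyclic subgroups. If its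
  centralizer \<open>C\<close> were larger, \<open>normal_central_step\<close> would give
  \<open>c\<close> in \<open>C\<close> whose conjugates lie in \<open>cyc x #> c\<close>. As
  \<open>c\<close> commutes with \<open>x\<close>, \<open>cyc x\<close> lies in
  \<open>cyc c\<close>, and \<open>cyc c\<close> is a larger normal cyclic subgroup.\<close>

lemma exists_self_centralizing:
  "\<exists>x \<in> carrier G. (\<forall>g \<in> carrier G. g \<otimes> x \<otimes> inv g \<in> cyc x) \<and>
    (\<forall>g \<in> carrier G. g \<otimes> x = x \<otimes> g \<longrightarrow> g \<in> cyc x)"
proof -
  define X where "X = {x \<in> carrier G. \<forall>g \<in> carrier G. g \<otimes> x \<otimes> inv g \<in> cyc x}"
  have "finite X" unfolding X_def using finite_carrier by simp
  \<comment> \<open>This makes \<open>X\<close> nonempty, so that a maximum exists.\<close>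
  moreover have "\<one> \<in> X" unfolding X_def using cyc_self by simp
  ultimately obtain x where x: "x \<in> X" "\<And>y. y \<in> X \<Longrightarrow> card (cyc y) \<le> card (cyc x)"
    using obtains_MAX[of X "\<lambda>x. card (cyc x)"] by (metis Max_ge empty_iff finite_imageI imageI)
  have xG: "x \<in> carrier G" and x_conj: "\<And>g. g \<in> carrier G \<Longrightarrow> g \<otimes> x \<otimes> inv g \<in> cyc x"
    using x(1) unfolding X_def by auto
  interpret A: subgroup "cyc x" G using xG by (rule cyc_subgroup)
  have A_normal: "cyc x \<lhd> G"
    unfolding normal_inv_iff using A.subgroup_axioms cyc_conj x_conj xG by blast
  define C where "C = {g \<in> carrier G. g \<otimes> x = x \<otimes> g}"
  have C_iff: "g \<in> C \<longleftrightarrow> g \<in> carrier G \<and> g \<otimes> x \<otimes> inv g = x" for g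
    unfolding C_def using xG inv_solve_right'[of x "g \<otimes> x" g] by auto
  have C_fixes: "g \<otimes> h \<otimes> inv g = h" if "g \<in> C" "h \<in> cyc x" for g h
  proof -
    obtain k :: nat where k: "h = x [^] k" using \<open>h \<in> cyc x\<close> cyc_iff xG by blast
    have "g \<otimes> h = h \<otimes> g"
      using \<open>g \<in> C\<close> xG group_commutes_pow[of x g k] unfolding k C_def by auto
    then show ?thesis
      using \<open>g \<in> C\<close> xG unfolding k C_def by (simp add: inv_solve_right')
  qed
  have conj_conj: "(g \<otimes> h) \<otimes> y \<otimes> inv (g \<otimes> h) = g \<otimes> (h \<otimes> y \<otimes> inv h) \<otimes> inv g"
    if "g \<in> carrier G" "h \<in> carrier G" "y \<in> carrier G" for g h y
    using that by (simp add: m_assoc inv_mult_group)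
  have "subgroup C G"
  proof (rule subgroupI)
    show "C \<subseteq> carrier G" unfolding C_def by blast
    show "C \<noteq> {}" unfolding C_def using xG by auto
  next
    fix g assume "g \<in> C"
    then show "inv g \<in> C"
      using C_iff conj_conj[of "inv g" g x] xG by simp
  next
    fix g h assume "g \<in> C" "h \<in> C"
    then show "g \<otimes> h \<in> C"
      using C_iff conj_conj[of g h x] xG by simp
  qed
  moreover have "g \<otimes> c \<otimes> inv g \<in> C" if g: "g \<in> carrier G" and c: "c \<in> C" for g c
  proof -
    have cG: "c \<in> carrier G" using c C_iff by blast
    \<comment> \<open>Conjugating back by \<open>g\<close> turns \<open>x\<close> into
      \<open>h\<close>, which is still in \<open>cyc x\<close> and so is fixed by
      \<open>c\<close>.\<close>
    define h where "h = inv g \<otimes> x \<otimes> inv (inv g)"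
    have h: "h \<in> cyc x" unfolding h_def using g by (intro x_conj) simp
    have "(g \<otimes> c \<otimes> inv g) \<otimes> x \<otimes> inv (g \<otimes> c \<otimes> inv g) = g \<otimes> (c \<otimes> h \<otimes> inv c) \<otimes> inv g"
      unfolding h_def using g cG xG by (simp add: m_assoc inv_mult_group)
    also have "\<dots> = g \<otimes> h \<otimes> inv g" using C_fixes[OF c h] by simp
    also have "\<dots> = x"
      unfolding h_def using g xG by (simp add: m_assoc) (simp add: xG flip: m_assoc)
    finally show ?thesis using C_iff g cG by simp
  qed
  ultimately have C_normal: "C \<lhd> G" unfolding normal_inv_iff by blast
  have "C \<subseteq> cyc x"
  proof (rule ccontr)
    assume "\<not> C \<subseteq> cyc x"
    then obtain c where c: "c \<in> C" "c \<notin> cyc x"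
      and conj: "\<And>g. g \<in> carrier G \<Longrightarrow> \<exists>a \<in> cyc x. g \<otimes> c \<otimes> inv g = a \<otimes> c"
      using normal_central_step[OF A_normal C_normal] by blast
    have cG: "c \<in> carrier G" and "c \<otimes> x = x \<otimes> c" using c(1) unfolding C_def by auto
    then have "x \<in> cyc c" using commuting_comparable[OF cG xG] c(2) by blast
    then have sub: "cyc x \<subseteq> cyc c" using cG by (intro cyc_mono)
    interpret D: subgroup "cyc c" G using cG by (rule cyc_subgroup)
    have "g \<otimes> c \<otimes> inv g \<in> cyc c" if g: "g \<in> carrier G" for g
    proof -
      obtain a where "a \<in> cyc x" "g \<otimes> c \<otimes> inv g = a \<otimes> c" using conj[OF g] by blast
      then show ?thesis using sub cyc_self[of c] D.m_closed by auto
    qed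
    then have "c \<in> X" unfolding X_def using cG by blast
    then have "card (cyc c) \<le> card (cyc x)" by (rule x(2))
    moreover have "finite (cyc c)" using finite_carrier D.subset finite_subset by blast
    ultimately have "cyc x = cyc c" using sub by (simp add: card_seteq)
    then show False using c(2) cyc_self[of c] by blast
  qed
  then show ?thesis using xG x_conj unfolding C_def by blast
qed

section \<open>Congruences for the exponent of the power map\<close>

lemma pow_p_cong:
  fixes r :: nat
  assumes "[r ^ p = 1] (mod p)"
  shows "[r = 1] (mod p)"
proof -
  have "\<not> p dvd r"
  proof
    assume "p dvd r"
    then have "p dvd r ^ p" using prime_gt_0_nat[OF prime_p] by (simp add: dvd_power_iff dvd_trans[of p r "r ^ p"])
    then have "p dvd 1" using assms cong_dvd_iff by blast
    then show False using prime_p by auto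
  qed
  then have "[r ^ (p - 1) * r = 1 * r] (mod p)"
    using fermat_theorem prime_p by (intro cong_scalar_right) blast
  then have "[r ^ p = r] (mod p)"
    using prime_gt_0_nat[OF prime_p] by (simp flip: power_Suc2)
  then show ?thesis using assms cong_sym cong_trans by blast
qed

end

text \<open>Modulo \<open>p^2\<close> the power \<open>(1 + p * s) ^ i\<close> is
  \<open>1 + i * p * s\<close>. Both sides are doubled to avoid halving
  \<open>n * (n - 1)\<close>.\<close>

lemma geometric_sum_mod_square:
  fixes p s :: int
  shows "[2 * (\<Sum>i<n. (1 + p * s) ^ i) = 2 * int n + int n * (int n - 1) * p * s] (mod p\<^sup>2)"
proof (induction n)
  case 0
  then show ?case by simp
next
  case (Suc n)
  let ?S = "\<lambda>n. \<Sum>i<n. (1 + p * s) ^ i"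
  have "?S (Suc n) = 1 + (1 + p * s) * ?S n"
    by (subst sum.lessThan_Suc_shift) (simp add: sum_distrib_left)
  then have "2 * ?S (Suc n) = 2 + (1 + p * s) * (2 * ?S n)"
    by (simp add: algebra_simps)
  also have "[\<dots> = 2 + (1 + p * s) * (2 * int n + int n * (int n - 1) * p * s)] (mod p\<^sup>2)"
    by (intro cong_add cong_mult cong_refl Suc)
  also have "2 + (1 + p * s) * (2 * int n + int n * (int n - 1) * p * s)
      = 2 * int (Suc n) + int (Suc n) * (int (Suc n) - 1) * p * s
        + p\<^sup>2 * (s\<^sup>2 * int n * (int n - 1))"
    by (simp add: algebra_simps power2_eq_square)
  also have "[\<dots> = 2 * int (Suc n) + int (Suc n) * (int (Suc n) - 1) * p * s] (mod p\<^sup>2)"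
    by (simp add: cong_def)
  finally show ?case .
qed

context p_group_unique_min
begin

section \<open>The elements outside the cyclic subgroup\<close>

text \<open>Everything rests on one obstruction: an element \<open>x [^] j \<otimes> y\<close> of
  exponent \<open>p\<close> would lie in \<open>cyc x\<close> by \<open>order_p_mem_cyc\<close>, and
  then so would \<open>y\<close>.\<close>

lemma twisted_square_eq_inverse:
  assumes x: "x \<in> carrier G"
    and conj: "\<forall>g \<in> carrier G. g \<otimes> x \<otimes> inv g \<in> cyc x"
    and centr: "\<forall>g \<in> carrier G. g \<otimes> x = x \<otimes> g \<longrightarrow> g \<in> cyc x"
    and y: "y \<in> carrier G" "y \<notin> cyc x" "y [^] p \<in> cyc x"
  shows "p = 2" and "y \<otimes> x = inv x \<otimes> y" and "y [^] (2::nat) \<noteq> \<one>"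
    and "(y [^] (2::nat)) [^] (2::nat) = \<one>"
proof -
  note x_conj = bspec[OF conj] and x_centr = mp[OF bspec[OF centr]]
  interpret A: subgroup "cyc x" G using x by (rule cyc_subgroup)
  obtain r :: nat where "y \<otimes> x \<otimes> inv y = x [^] r"
    using cyc_iff x_conj x y by blast
  then have twist: "y \<otimes> x = x [^] r \<otimes> y"
    using x y by (simp add: inv_solve_right')
  have "x \<noteq> \<one>" using x_centr[of y] y x by auto
  obtain m where m: "ord x = p ^ m" using ord_prime_power x by blast
  have p_ord: "p dvd ord x" using p_dvd_ord x \<open>x \<noteq> \<one>\<close> .
  \<comment> \<open>Stated for every \<open>x [^] j \<otimes> y\<close>, since it is used for
    \<open>y\<close> and later for \<open>x \<otimes> y\<close>.\<close>
  have outside: "z \<in> carrier G" "\<exists>k. z [^] p = x [^] (p * k)"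
    "\<not> (\<exists>u. (\<Sum>i<p. r ^ i) = p * u \<and> \<not> p dvd u)" "z \<otimes> x = x [^] r \<otimes> z"
    if z: "z \<in> (\<lambda>j. x [^] j \<otimes> y) ` (UNIV :: nat set)" and zp: "z [^] p \<in> cyc x" for z
  proof -
    obtain l :: nat where l: "z = x [^] l \<otimes> y" using z by blast
    show zG: "z \<in> carrier G" using l x y by simp
    have z_notin: "x [^] j \<otimes> z \<notin> cyc x" for j :: nat
    proof
      assume "x [^] j \<otimes> z \<in> cyc x"
      then have "x [^] (j + l) \<otimes> y \<in> cyc x"
        using l x y by (simp add: m_assoc flip: nat_pow_mult)
      then have "inv (x [^] (j + l)) \<otimes> (x [^] (j + l) \<otimes> y) \<in> cyc x"
        using A.m_inv_closed[OF cyc_powI[OF x]] A.m_closed by blast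
      moreover have "inv (x [^] (j + l)) \<otimes> (x [^] (j + l) \<otimes> y) = y"
        using x y by (simp add: inv_solve_left')
      ultimately show False using y by simp
    qed
    have "z \<otimes> x = x [^] l \<otimes> x [^] r \<otimes> y"
      using l x y twist by (simp add: m_assoc)
    also have "\<dots> = x [^] r \<otimes> x [^] l \<otimes> y"
      using x by (simp add: nat_pow_comm)
    finally show twist_z: "z \<otimes> x = x [^] r \<otimes> z"
      using l x y by (simp add: m_assoc)
    obtain k :: nat where k: "z [^] p = x [^] k" using zp cyc_iff x by blast
    \<comment> \<open>If not, \<open>x\<close> is a power of \<open>z\<close>, so \<open>z\<close>
      commutes with \<open>x\<close> and falls into \<open>cyc x\<close>.\<close>
    have "p dvd k"
    proof (rule ccontr)
      assume "\<not> p dvd k"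
      then have "x \<in> cyc (z [^] p)" using mem_cyc_coprime_pow x k by simp
      then have "x \<in> cyc z" using cyc_mono[OF zG cyc_powI[OF zG]] by blast
      then obtain i :: nat where "x = z [^] i" using cyc_iff zG by blast
      then have "z \<otimes> x = x \<otimes> z" using zG group_commutes_pow[of z z i] by simp
      then have "z \<in> cyc x" using x_centr zG by blast
      then show False using z_notin[of 0] zG by simp
    qed
    then obtain k' where k': "k = p * k'" by auto
    then show "\<exists>k. z [^] p = x [^] (p * k)" using k by blast
    show "\<not> (\<exists>u. (\<Sum>i<p. r ^ i) = p * u \<and> \<not> p dvd u)"
    proof
      assume "\<exists>u. (\<Sum>i<p. r ^ i) = p * u \<and> \<not> p dvd u"
      then obtain u where u: "(\<Sum>i<p. r ^ i) = p * u" "\<not> p dvd u" by blast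
      have "coprime u (p ^ m)"
        using u(2) prime_p by (metis coprime_commute coprime_power_left_iff prime_imp_coprime)
      then obtain v where v: "[u * v = 1] (mod p ^ m)"
        using cong_solve_coprime_nat by (metis One_nat_def)
      define q where "q = p ^ m"
      \<comment> \<open>This \<open>j\<close> solves \<open>j * u = - k'\<close> modulo
        \<open>q\<close>: \<open>v\<close> inverts \<open>u\<close>, and \<open>k' * (q - 1)\<close>
        is a natural number standing for \<open>- k'\<close>. It makes the p-th power of
        \<open>x [^] j \<otimes> z\<close> trivial.\<close>
      define j where "j = v * (k' * (q - 1))"
      have "q > 0" unfolding q_def using prime_gt_0_nat[OF prime_p] by simp
      have "[j * u + k' = k' * (q - 1) + k'] (mod q)"
        using cong_add[OF cong_scalar_right[OF v, of "k' * (q - 1)"] cong_refl[of k']]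
        unfolding j_def q_def by (simp add: mult_ac)
      also have "k' * (q - 1) + k' = k' * q"
        using \<open>q > 0\<close> by (cases q) (simp_all add: algebra_simps)
      finally have "[j * u + k' = 0] (mod q)" by (simp add: cong_def)
      then have "q dvd j * u + k'" by (simp add: cong_0_iff)
      then have "q dvd p * (j * u + k')" by simp
      then have "x [^] (p * (j * u + k')) = \<one>"
        using pow_eq_id x m unfolding q_def by simp
      moreover have "(x [^] j \<otimes> z) [^] p = x [^] (j * (p * u)) \<otimes> x [^] (p * k')"
        using twist_mult_pow[OF x zG twist_z, of j p] k k' u(1) by simp
      then have "(x [^] j \<otimes> z) [^] p = x [^] (p * (j * u + k'))"
        using x by (simp add: nat_pow_mult algebra_simps)
      ultimately have "x [^] j \<otimes> z \<in> cyc x"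
        using order_p_mem_cyc[of "x [^] j \<otimes> z" x] x zG \<open>x \<noteq> \<one>\<close> by simp
      then show False using z_notin by blast
    qed
  qed
  have y_in: "y \<in> (\<lambda>j. x [^] j \<otimes> y) ` (UNIV :: nat set)"
    using y x by (intro image_eqI[of _ _ 0]) auto
  note y_facts = outside[OF y_in y(3)]
  obtain k :: nat where k: "y [^] p = x [^] (p * k)" using y_facts by blast
  \<comment> \<open>As a power of \<open>x\<close>, \<open>y [^] p\<close> acts trivially on
    \<open>x\<close>; it also acts by \<open>r ^ p\<close>, which is therefore 1 modulo the order of
    \<open>x\<close>.\<close>
  have "y [^] p \<otimes> x = x \<otimes> y [^] p"
    unfolding k using x by (intro group_commutes_pow) auto
  then have "x [^] (r ^ p) \<otimes> y [^] p = x [^] (1::nat) \<otimes> y [^] p"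
    using twist_pow_pow[OF x y(1) twist, of p] x by simp
  then have "x [^] (r ^ p) = x [^] (1::nat)"
    using x y right_cancel by simp
  then have "[r ^ p = 1] (mod ord x)" using x pow_eq_imp_cong by blast
  then have "[r ^ p = 1] (mod p)" using p_ord by (rule cong_dvd_modulus_nat)
  then have r_p: "[r = 1] (mod p)" by (rule pow_p_cong)
  then have "[1 = int r] (mod int p)" using cong_int_iff[of 1 r p] cong_sym_eq[of 1 r p] by simp
  then obtain s where s: "int r = 1 + int p * s" unfolding cong_iff_lin by blast
  \<comment> \<open>All \<open>p\<close> summands are 1 modulo \<open>p\<close>. The third fact in
    \<open>outside\<close> then supplies a second factor \<open>p\<close>.\<close>
  have p_sum: "p dvd (\<Sum>i<p. r ^ i)"
  proof -
    have "[(\<Sum>i<p. r ^ i) = (\<Sum>i<p. 1)] (mod p)"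
      using cong_pow[OF r_p] by (intro cong_sum) simp
    then show ?thesis by (simp add: cong_def dvd_eq_mod_eq_0)
  qed
  then obtain u where u: "(\<Sum>i<p. r ^ i) = p * u" by auto
  then have "p dvd u" using y_facts(3) by blast
  then have sq: "p\<^sup>2 dvd (\<Sum>i<p. r ^ i)" using u by (simp add: power2_eq_square)
  show "p = 2"
  proof -
    have "(\<Sum>i<p. (1 + int p * s) ^ i) = int (\<Sum>i<p. r ^ i)"
      by (simp add: s)
    then have "(int p)\<^sup>2 dvd 2 * (\<Sum>i<p. (1 + int p * s) ^ i)"
      using sq by (metis dvd_mult int_dvd_int_iff of_nat_power)
    then have "(int p)\<^sup>2 dvd 2 * int p + int p * (int p - 1) * int p * s"
      using geometric_sum_mod_square[where p = "int p" and s = s and n = p] cong_dvd_iff by blast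
    \<comment> \<open>The quadratic term vanishes modulo \<open>p^2\<close>, which leaves
      \<open>p^2\<close> dividing \<open>2 * p\<close>.\<close>
    moreover have "int p * (int p - 1) * int p * s = (int p)\<^sup>2 * ((int p - 1) * s)"
      by (simp add: power2_eq_square)
    ultimately have "(int p)\<^sup>2 dvd 2 * int p"
      by (metis dvd_add_left_iff dvd_triv_left)
    then have "p * p dvd 2 * p"
      by (metis int_dvd_int_iff of_nat_mult of_nat_numeral power2_eq_square)
    then have "p dvd 2" using prime_gt_0_nat[OF prime_p] by simp
    then show ?thesis using prime_p primes_dvd_imp_eq two_is_prime_nat by blast
  qed
  have sum2: "(\<Sum>i<p. r ^ i) = 1 + r" using \<open>p = 2\<close> by (simp add: numeral_2_eq_2)
  have "4 dvd 1 + r" using sq sum2 \<open>p = 2\<close> by simp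
  then obtain t where t: "r - 1 = 2 * t" "odd t" "r \<ge> 1"
  proof -
    from \<open>4 dvd 1 + r\<close> obtain q where "1 + r = 4 * q" by auto
    then show thesis by (intro that[of "2 * q - 1"]) (cases q; simp)+
  qed
  have square: "z [^] (2::nat) \<noteq> \<one>" "(z [^] (2::nat)) [^] (2::nat) = \<one>"
    if z: "z \<in> (\<lambda>j. x [^] j \<otimes> y) ` (UNIV :: nat set)" and zp: "z [^] p \<in> cyc x" "z \<notin> cyc x" for z
  proof -
    note z_facts = outside[OF z zp(1)]
    obtain k :: nat where k: "z [^] (2::nat) = x [^] (2 * k)" using z_facts(2) \<open>p = 2\<close> by auto
    show "z [^] (2::nat) \<noteq> \<one>"
      using order_p_mem_cyc[of z x] z_facts(1) x \<open>x \<noteq> \<one>\<close> zp(2) \<open>p = 2\<close> by auto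
    \<comment> \<open>\<open>z\<close> commutes with its own square \<open>x [^] (2 * k)\<close>, so
      the order of \<open>x\<close> divides \<open>(r - 1) * (2 * k) = t * (4 * k)\<close>. Since
      \<open>t\<close> is odd, it divides \<open>4 * k\<close>, the exponent of the fourth power of
      \<open>z\<close>.\<close>
    have "z \<otimes> x [^] (2 * k) = x [^] (2 * k) \<otimes> z"
      using group_commutes_pow[of z z "2::nat"] z_facts(1) unfolding k[symmetric] by simp
    moreover have "z \<otimes> x [^] (2 * k) = x [^] (r * (2 * k)) \<otimes> z"
      using z_facts x by (intro twist_pow)
    ultimately have "x [^] (r * (2 * k)) = x [^] (2 * k)"
      using x z_facts(1) right_cancel by simp
    then have "[r * (2 * k) = 2 * k] (mod ord x)" using x pow_eq_imp_cong by blast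
    then have "ord x dvd r * (2 * k) - 2 * k"
      using t(3) cong_altdef_nat[of "2 * k" "r * (2 * k)" "ord x"] by simp
    also have "r * (2 * k) - 2 * k = (r - 1) * (2 * k)" by (simp add: diff_mult_distrib)
    also have "\<dots> = t * (4 * k)" using t by simp
    finally have "2 ^ m dvd t * (4 * k)" using m \<open>p = 2\<close> by simp
    moreover have "coprime (2 ^ m) t" using t(2) by simp
    ultimately have "2 ^ m dvd 4 * k" by (simp add: coprime_dvd_mult_right_iff)
    then have "x [^] (4 * k) = \<one>" using pow_eq_id x m \<open>p = 2\<close> by simp
    then show "(z [^] (2::nat)) [^] (2::nat) = \<one>"
      unfolding k using x by (simp add: nat_pow_pow mult.commute)
  qed
  note y_sq = square[OF y_in y(3,2)]
  show "y [^] (2::nat) \<noteq> \<one>" "(y [^] (2::nat)) [^] (2::nat) = \<one>" by (fact y_sq)+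
  \<comment> \<open>The squares of \<open>y\<close> and of \<open>x \<otimes> y\<close> are both
    involutions, hence equal, and comparing them gives
    \<open>x [^] (1 + r) = \<one>\<close>.\<close>
  define z where "z = x \<otimes> y"
  have z_in: "z \<in> (\<lambda>j. x [^] j \<otimes> y) ` (UNIV :: nat set)"
    unfolding z_def using x by (intro image_eqI[of _ _ 1]) auto
  have "z [^] (2::nat) = x [^] (1 + r) \<otimes> y [^] (2::nat)"
    using twist_mult_pow[OF x y(1) twist, of 1 2] x unfolding z_def by (simp add: numeral_2_eq_2)
  moreover have "z \<notin> cyc x"
  proof
    assume "z \<in> cyc x"
    then have "inv x \<otimes> z \<in> cyc x" using A.m_closed A.m_inv_closed[OF cyc_self] by blast
    then show False using y(2) x y(1) unfolding z_def by (simp add: inv_solve_left' flip: m_assoc)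
  qed
  moreover have zp: "z [^] p \<in> cyc x"
    using calculation(1) A.m_closed[OF cyc_powI[OF x, of "1 + r"] y(3)] \<open>p = 2\<close> by simp
  ultimately have z_sq: "z [^] (2::nat) \<noteq> \<one>" "(z [^] (2::nat)) [^] (2::nat) = \<one>"
    using square[OF z_in] by blast+
  have "z [^] (2::nat) \<in> cyc (y [^] (2::nat))"
    using order_p_mem_cyc y_sq z_sq \<open>p = 2\<close> y(1) x unfolding z_def by simp
  then have "z [^] (2::nat) = y [^] (2::nat)"
    using cyc_involution[of "y [^] (2::nat)"] y(1) y_sq z_sq by auto
  then have "x [^] (1 + r) = \<one>"
    using \<open>z [^] (2::nat) = x [^] (1 + r) \<otimes> y [^] (2::nat)\<close> x y(1) by (simp add: l_cancel_one')
  then have "x [^] r = inv x"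
    using x by (intro inv_equality[symmetric]) auto
  then show "y \<otimes> x = inv x \<otimes> y" using twist by simp
qed

text \<open>Once p-th powers are known to lie in \<open>cyc x\<close>, every element outside
  \<open>cyc x\<close> inverts \<open>x\<close>. Two such elements differ by one that centralizes
  \<open>x\<close>, so there are just two cosets.\<close>

lemma generalized_quaternion_if_not_comm:
  assumes "\<not> comm_group G"
  shows "generalized_quaternion G"
proof -
  obtain x where x: "x \<in> carrier G"
    and conj: "\<forall>g \<in> carrier G. g \<otimes> x \<otimes> inv g \<in> cyc x"
    and centr: "\<forall>g \<in> carrier G. g \<otimes> x = x \<otimes> g \<longrightarrow> g \<in> cyc x"
    using exists_self_centralizing by blast
  note x_conj = bspec[OF conj] and x_centr = mp[OF bspec[OF centr]]
  interpret A: subgroup "cyc x" G using x by (rule cyc_subgroup)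
  obtain m where m: "ord x = p ^ m" using ord_prime_power x by blast
  have not_square_one: "x [^] (2::nat) \<noteq> \<one>"
    if g: "g \<in> carrier G" "g \<notin> cyc x" "g \<otimes> x = inv x \<otimes> g" for g
  proof
    assume "x [^] (2::nat) = \<one>"
    then have "inv x = x" using x by (intro inv_equality) (simp_all add: numeral_2_eq_2)
    then show False using g x_centr by simp
  qed
  \<comment> \<open>Let \<open>k\<close> be least with \<open>g [^] (p ^ k)\<close> in
    \<open>cyc x\<close>. If \<open>k\<close> were at least 2, the preceding iterate
    \<open>z\<close> would invert \<open>x\<close> and also be the square of some \<open>w\<close>.
    With \<open>w\<close> acting by \<open>r\<close>, this makes \<open>r^2 + 1\<close> divisible by
    \<open>2 ^ m\<close>, hence by 4, which no square allows.\<close>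
  have square_mem: "g [^] p \<in> cyc x" if g: "g \<in> carrier G" "g \<notin> cyc x" for g
  proof -
    obtain n where "ord g = p ^ n" using ord_prime_power g by blast
    then have "g [^] (p ^ n) = \<one>" using g pow_eq_id by simp
    then have "g [^] (p ^ n) \<in> cyc x" using A.one_closed by argo
    then obtain k where k: "g [^] (p ^ k) \<in> cyc x" "\<And>i. i < k \<Longrightarrow> g [^] (p ^ i) \<notin> cyc x"
      using exists_least_iff[of "\<lambda>k. g [^] (p ^ k) \<in> cyc x"] by blast
    have "k \<noteq> 0"
    proof
      assume "k = 0"
      then show False using k(1) g by simp
    qed
    have "k < 2"
    proof (rule ccontr)
      assume "\<not> k < 2"
      then obtain l where l: "k = Suc (Suc l)" by (metis add_2_eq_Suc le_Suc_ex not_less)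
      define z where "z = g [^] (p ^ Suc l)"
      define w where "w = g [^] (p ^ l)"
      have zG: "z \<in> carrier G" and wG: "w \<in> carrier G" unfolding z_def w_def using g by auto
      have z: "z \<notin> cyc x" unfolding z_def using k(2)[of "Suc l"] l by simp
      have "z [^] p = g [^] (p ^ k)"
        unfolding z_def l using g by (simp add: nat_pow_pow mult.commute)
      then have "z [^] p \<in> cyc x" using k(1) by simp
      note z_facts = twisted_square_eq_inverse[OF x conj centr zG z this]
      have wz: "w [^] (2::nat) = z"
        unfolding w_def z_def using g z_facts(1) by (simp add: nat_pow_pow mult.commute)
      obtain r :: nat where "w \<otimes> x \<otimes> inv w = x [^] r" using cyc_iff x_conj x wG by blast
      then have "w \<otimes> x = x [^] r \<otimes> w" using x wG by (simp add: inv_solve_right')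
      then have "z \<otimes> x = x [^] (r\<^sup>2) \<otimes> z" unfolding wz[symmetric] by (rule twist_pow_pow[OF x wG])
      then have "x [^] (r\<^sup>2) = inv x" using z_facts(2) zG x by simp
      then have "x [^] Suc (r\<^sup>2) = \<one>" using x by simp
      then have "2 ^ m dvd Suc (r\<^sup>2)"
        using x pow_eq_id[of x "Suc (r\<^sup>2)"] m z_facts(1) by (simp del: nat_pow_Suc)
      moreover have "m \<ge> 2"
      proof (rule ccontr)
        assume "\<not> m \<ge> 2"
        then have "(2::nat) ^ m dvd 2 ^ 1" by (intro le_imp_power_dvd) simp
        then have "x [^] (2::nat) = \<one>" using x pow_eq_id m z_facts(1) by simp
        then show False using not_square_one zG z z_facts(2) by blast
      qed
      then have "(2::nat) ^ 2 dvd 2 ^ m" by (rule le_imp_power_dvd)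
      ultimately have "4 dvd Suc (r\<^sup>2)" using dvd_trans[of "2 ^ 2" "2 ^ m" "Suc (r\<^sup>2)"] by simp
      then show False
      proof (cases "even r")
        case True
        then obtain q where "r = 2 * q" by auto
        then have "Suc (r\<^sup>2) mod 4 = 1" by (simp add: power2_eq_square mod_Suc)
        then show False using \<open>4 dvd Suc (r\<^sup>2)\<close> by simp
      next
        case False
        then obtain q where "r = 2 * q + 1" using oddE by blast
        then have "Suc (r\<^sup>2) = 4 * (q * q + q) + 2" by (simp add: power2_eq_square algebra_simps)
        then have "Suc (r\<^sup>2) mod 4 = 2" by presburger
        then show False using \<open>4 dvd Suc (r\<^sup>2)\<close> by simp
      qed
    qed
    then have "k = 1" using \<open>k \<noteq> 0\<close> by simp
    then show ?thesis using k(1) by simp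
  qed
  note outside = twisted_square_eq_inverse[OF x conj centr _ _ square_mem]
  have "\<exists>y \<in> carrier G. y \<notin> cyc x"
  proof (rule ccontr)
    assume "\<not> ?thesis"
    then have all: "\<And>g. g \<in> carrier G \<Longrightarrow> g \<in> cyc x" by blast
    have "comm_group G"
    proof (rule group_comm_groupI)
      fix g h assume "g \<in> carrier G" "h \<in> carrier G"
      then obtain i j :: nat where "g = x [^] i" "h = x [^] j"
        using all cyc_iff[OF x] by meson
      then show "g \<otimes> h = h \<otimes> g" using x by (simp add: nat_pow_mult add.commute)
    qed
    then show False using assms by blast
  qed
  then obtain y where y: "y \<in> carrier G" "y \<notin> cyc x" by blast
  note y_facts = outside[OF y y]
  have p: "p = 2" by (fact y_facts(1))
  have inv_y: "inv y \<in> carrier G" "inv y \<notin> cyc x"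
    using y A.m_inv_closed[of "inv y"] by auto
  have inv_y_x: "inv y \<otimes> x = inv x \<otimes> inv y" by (rule outside(2)[OF inv_y inv_y])
  have "m \<ge> 2"
  proof (rule ccontr)
    assume "\<not> m \<ge> 2"
    then have "(2::nat) ^ m dvd 2 ^ 1" by (intro le_imp_power_dvd) simp
    then have "x [^] (2::nat) = \<one>" using x pow_eq_id m p by simp
    then show False using not_square_one y y_facts(2) by blast
  qed
  \<comment> \<open>Both \<open>g\<close> and \<open>inv y\<close> invert \<open>x\<close>, so
    \<open>g \<otimes> inv y\<close> centralizes it.\<close>
  have split: "g \<in> cyc x #> y" if g: "g \<in> carrier G" "g \<notin> cyc x" for g
  proof -
    have "g \<otimes> x = inv x \<otimes> g" by (rule outside(2)[OF g g])
    then have "g = x \<otimes> (g \<otimes> x)" using g x inv_solve_left[of "g \<otimes> x" x g] by simp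
    then have "g \<otimes> inv x = x \<otimes> g"
      using g x inv_solve_right'[of "x \<otimes> g" g x] by (simp add: m_assoc)
    moreover have "(g \<otimes> inv y) \<otimes> x = (g \<otimes> inv x) \<otimes> inv y"
      using g x y inv_y_x by (simp add: m_assoc)
    ultimately have "(g \<otimes> inv y) \<otimes> x = x \<otimes> (g \<otimes> inv y)"
      using g x y by (simp add: m_assoc)
    then have "g \<otimes> inv y \<in> cyc x" using x_centr g y by simp
    then show ?thesis using A.rcos_module[OF is_group] y g by blast
  qed
  have carrier_eq: "carrier G = cyc x \<union> (cyc x #> y)"
    using split A.subset r_coset_subset_G[OF A.subset y(1)] by blast
  have disj: "cyc x \<inter> (cyc x #> y) = {}"
  proof (rule ccontr)
    assume "cyc x \<inter> (cyc x #> y) \<noteq> {}"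
    then obtain a where a: "a \<in> cyc x" "a \<in> cyc x #> y" by blast
    then have "a \<otimes> inv y \<in> cyc x" using A.rcos_module[OF is_group] y by simp
    then have "inv a \<otimes> (a \<otimes> inv y) \<in> cyc x" using A.m_closed A.m_inv_closed[OF a(1)] by blast
    then show False using a(1) y inv_y by (simp flip: m_assoc)
  qed
  obtain f where "bij_betw f (cyc x) (cyc x #> y)"
    using card_cosets_equal[OF rcosetsI[OF A.subset y(1)] A.subset] by blast
  then have "card (cyc x #> y) = card (cyc x)" using bij_betw_same_card by metis
  moreover have "finite (cyc x)" "finite (cyc x #> y)"
    using finite_carrier carrier_eq by (metis finite_Un)+
  ultimately have "order G = card (cyc x) + card (cyc x)"
    unfolding order_def carrier_eq using disj by (simp add: card_Un_disjoint)
  then have order: "order G = 2 ^ Suc m"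
    using generate_pow_card[OF x] m p by simp
  have gen: "generate G {x, y} = carrier G"
  proof
    show "generate G {x, y} \<subseteq> carrier G" using generate_incl x y by simp
    have sub: "cyc x \<subseteq> generate G {x, y}" by (rule mono_generate) simp
    moreover have "cyc x #> y \<subseteq> generate G {x, y}"
    proof
      fix g assume "g \<in> cyc x #> y"
      then obtain a where "a \<in> cyc x" "g = a \<otimes> y" unfolding r_coset_def by blast
      then show "g \<in> generate G {x, y}"
        using sub generate.incl[of y "{x, y}" G] generate.eng by fast
    qed
    ultimately show "carrier G \<subseteq> generate G {x, y}" unfolding carrier_eq by blast
  qed
  \<comment> \<open>This is the involution of \<open>cyc x\<close>. By uniqueness
    \<open>y [^] 2\<close> must equal it, which is the remaining quaternion relation with
    \<open>n = Suc m\<close>.\<close>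
  define w where "w = x [^] (2 ^ (m - 1) :: nat)"
  have wG: "w \<in> carrier G" unfolding w_def using x by simp
  have "Suc (m - 1) = m" using \<open>m \<ge> 2\<close> by simp
  then have half: "2 ^ (m - 1) * 2 = (2 ^ m :: nat)" by (metis power_Suc2)
  have "w [^] (2::nat) = \<one>"
    unfolding w_def using x pow_eq_id m p half by (simp add: nat_pow_pow)
  moreover have "\<not> 2 ^ m dvd (2 ^ (m - 1) :: nat)"
    using power_dvd_imp_le[of "2::nat" m "m - 1"] \<open>m \<ge> 2\<close> by auto
  then have "w \<noteq> \<one>" unfolding w_def using x pow_eq_id m p by simp
  moreover have "y [^] (2::nat) \<in> cyc w"
    using order_p_mem_cyc y_facts(4) p y(1) wG \<open>w \<noteq> \<one>\<close> by simp
  ultimately have "y [^] (2::nat) = w" using cyc_involution wG y_facts(3) by blast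
  moreover have "inv y \<otimes> x \<otimes> y = inv x" using inv_y_x x y by (simp add: m_assoc)
  moreover have "x [^] (2 ^ m :: nat) = \<one>" using x pow_eq_id m p by simp
  ultimately show ?thesis
    unfolding generalized_quaternion_def
    using order gen x y(1) \<open>m \<ge> 2\<close> is_group unfolding w_def
    by (intro conjI exI[of _ "Suc m"] bexI[of _ x] bexI[of _ y]) (simp_all add: numeral_2_eq_2)
qed

end

section \<open>Cone vertices\<close>

lemma is_cone_vertex_iff:
  "is_cone_vertex G v \<longleftrightarrow> v \<in> carrier G \<and> v \<noteq> \<one>\<^bsub>G\<^esub> \<and>
    (\<forall>u \<in> carrier G. u \<noteq> v \<longrightarrow>
      (\<exists>z \<in> carrier G. \<exists>(m::nat) (n::nat). v = z [^]\<^bsub>G\<^esub> m \<and> u = z [^]\<^bsub>G\<^esub> n))"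
  unfolding is_cone_vertex_def enhanced_power_graph_def by auto

text \<open>Let \<open>c\<close> be a cone vertex and \<open>c [^] k\<close> a power of it of order
  \<open>p\<close>. Sharing a cyclic subgroup with \<open>c\<close> puts \<open>u\<close> in
  \<open>cyc c\<close>, so \<open>u\<close> is a power of \<open>c [^] k\<close>, and likewise
  \<open>c [^] k\<close> is a power of \<open>v\<close>.\<close>

lemma (in finite_p_group) unique_min_if_cone_property:
  assumes "cone_property G"
  shows "p_group_unique_min G p"
proof unfold_locales
  obtain c where c: "c \<in> carrier G" "c \<noteq> \<one>"
    and adj: "\<And>u. u \<in> carrier G \<Longrightarrow> u \<noteq> c \<Longrightarrow>
      \<exists>z \<in> carrier G. \<exists>(m::nat) (n::nat). c = z [^] m \<and> u = z [^] n"
    using assms unfolding cone_property_def is_cone_vertex_iff by blast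
  have common: "\<exists>z \<in> carrier G. c \<in> cyc z \<and> u \<in> cyc z" if "u \<in> carrier G" for u
  proof (cases "u = c")
    case True
    then show ?thesis using c cyc_self by blast
  next
    case False
    then show ?thesis using adj that cyc_powI by metis
  qed
  fix u v assume u: "u \<in> carrier G" "u [^] p = \<one>" and v: "v \<in> carrier G" "v \<noteq> \<one>"
  obtain k :: nat where k: "c [^] k \<noteq> \<one>" "(c [^] k) [^] p = \<one>"
    using exists_pow_order_p c by blast
  have "u \<in> cyc c"
    using common[OF u(1)] mem_cyc_of_pow_p u(2) c(2) by blast
  then have "u \<in> cyc (c [^] k)"
    using mem_cyc_of_pow_p c(1) cyc_powI u(2) k(1) by blast
  moreover obtain z where "z \<in> carrier G" "c \<in> cyc z" "v \<in> cyc z" using common v(1) by blast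
  then have "c [^] k \<in> cyc v"
    using mem_cyc_of_pow_p cyc_pow_closed k(2) v(2) by blast
  ultimately show "u \<in> cyc v" using cyc_mono v(1) by blast
qed

section \<open>The involution of a generalized quaternion group\<close>

text \<open>The cone vertex is \<open>w = y [^] 2\<close>. It is a power of every
  \<open>u \<noteq> \<one>\<close>, so \<open>u\<close> itself is the common root of
  \<open>w\<close> and \<open>u\<close>.\<close>

lemma (in group) cone_property_if_generalized_quaternion:
  assumes "generalized_quaternion G"
  shows "cone_property G"
proof -
  obtain n x y where n: "n \<ge> 3" and order: "order G = 2 ^ n"
    and x: "x \<in> carrier G" and y: "y \<in> carrier G" and gen: "generate G {x, y} = carrier G"
    and x_pow: "x [^] (2 ^ (n - 1) :: nat) = \<one>"
    and y_sq: "y [^] (2 :: nat) = x [^] (2 ^ (n - 2) :: nat)"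
    and conj: "inv y \<otimes> x \<otimes> y = inv x"
    using assms unfolding generalized_quaternion_def by blast
  obtain d where d: "n = d + 2" using n by (metis add.commute le_Suc_ex add_leD2 numeral_3_eq_3 numeral_2_eq_2 Suc_leD)
  define w where "w = x [^] (2 ^ d :: nat)"
  have wG: "w \<in> carrier G" unfolding w_def using x by simp
  have y_w: "y [^] (2 :: nat) = w" using y_sq d unfolding w_def by simp
  have w_sq: "w [^] (2 :: nat) = \<one>" using x_pow d x unfolding w_def by (simp add: nat_pow_pow mult.commute)
  have ord_x: "ord x dvd 2 ^ Suc d" using x_pow d x pow_eq_id by simp
  \<comment> \<open>A natural exponent that acts as -1, because
    \<open>x [^] (2 ^ Suc d) = \<one>\<close>.\<close>
  define r :: nat where "r = 2 ^ Suc d - 1"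
  have "Suc r = 2 ^ Suc d" unfolding r_def by simp
  then have "x [^] Suc r = \<one>" using x_pow d by simp
  then have x_r: "x [^] r = inv x" using x by (intro inv_equality[symmetric]) auto
  have "x \<otimes> y = y \<otimes> inv x"
    using conj x y inv_solve_left'[of "inv x" y "x \<otimes> y"] by (simp add: m_assoc)
  then have "x \<otimes> (y \<otimes> x) = y" using x y by (simp flip: m_assoc) (simp add: m_assoc)
  then have twist: "y \<otimes> x = x [^] r \<otimes> y"
    unfolding x_r using x y inv_solve_left[of "y \<otimes> x" x y] by simp
  have mem: "\<exists>(i::nat) (j::nat). g = x [^] i \<otimes> y [^] j" if "g \<in> generate G {x, y}" for g
    using that
  proof induction
    case one
    have "\<one> = x [^] (0::nat) \<otimes> y [^] (0::nat)" by simp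
    then show ?case by blast
  next
    case (incl h)
    then have "h = x [^] (1::nat) \<otimes> y [^] (0::nat) \<or> h = x [^] (0::nat) \<otimes> y [^] (1::nat)"
      using x y by auto
    then show ?case by blast
  next
    case (inv h)
    have "y [^] (3::nat) \<otimes> y = (y [^] (2::nat)) [^] (2::nat)"
      using y by (simp add: nat_pow_pow numeral_eq_Suc m_assoc)
    then have "inv y = y [^] (3::nat)"
      using y y_w w_sq by (intro inv_equality) auto
    then have "inv h = x [^] r \<otimes> y [^] (0::nat) \<or> inv h = x [^] (0::nat) \<otimes> y [^] (3::nat)"
      using inv x y x_r by auto
    then show ?case by blast
  next
    case (eng h1 h2)
    then obtain i1 j1 i2 j2 :: nat where h: "h1 = x [^] i1 \<otimes> y [^] j1" "h2 = x [^] i2 \<otimes> y [^] j2"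
      by blast
    have "h1 \<otimes> h2 = x [^] i1 \<otimes> (y [^] j1 \<otimes> x [^] i2) \<otimes> y [^] j2"
      unfolding h using x y by (simp add: m_assoc)
    also have "y [^] j1 \<otimes> x [^] i2 = x [^] (r ^ j1 * i2) \<otimes> y [^] j1"
      by (rule twist_pow) (use x y twist_pow_pow[OF x y twist] in auto)
    also have "x [^] i1 \<otimes> (x [^] (r ^ j1 * i2) \<otimes> y [^] j1) \<otimes> y [^] j2
        = (x [^] i1 \<otimes> x [^] (r ^ j1 * i2)) \<otimes> (y [^] j1 \<otimes> y [^] j2)"
      using x y by (simp add: m_assoc)
    also have "\<dots> = x [^] (i1 + r ^ j1 * i2) \<otimes> y [^] (j1 + j2)"
      using x y by (simp add: nat_pow_mult)
    finally show ?case by blast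
  qed
  \<comment> \<open>An even power of \<open>y\<close> is a power of \<open>w\<close>, hence of
    \<open>x\<close>, so only the parity of \<open>j\<close> survives.\<close>
  have form: "\<exists>i::nat. g = x [^] i \<or> g = x [^] i \<otimes> y" if g: "g \<in> carrier G" for g
  proof -
    obtain i j :: nat where ij: "g = x [^] i \<otimes> y [^] j" using mem g gen by blast
    have "y [^] j = y [^] (2 * (j div 2) + j mod 2)" by simp
    also have "\<dots> = (y [^] (2::nat)) [^] (j div 2) \<otimes> y [^] (j mod 2)"
      using y by (simp add: nat_pow_pow nat_pow_mult)
    also have "\<dots> = x [^] (2 ^ d * (j div 2)) \<otimes> y [^] (j mod 2)"
      unfolding y_w w_def using x by (simp add: nat_pow_pow)
    finally have "g = x [^] (i + 2 ^ d * (j div 2)) \<otimes> y [^] (j mod 2)"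
      unfolding ij using x y by (simp add: m_assoc flip: nat_pow_mult)
    moreover have "y [^] (j mod 2) = \<one> \<or> y [^] (j mod 2) = y"
      using y by (cases "even j") (auto simp: odd_iff_mod_2_eq_one)
    ultimately show ?thesis using x by (metis r_one nat_pow_closed)
  qed
  \<comment> \<open>The relations alone cannot exclude collapse; the order does. If \<open>w\<close>
    were trivial, exponents of \<open>x\<close> could be reduced modulo \<open>2 ^ d\<close>, and
    \<open>form\<close> would leave at most \<open>2 * 2 ^ d\<close> elements instead of
    \<open>2 ^ (d + 2)\<close>.\<close>
  have w_ne: "w \<noteq> \<one>"
  proof
    assume "w = \<one>"
    then have ord_x': "ord x dvd 2 ^ d" unfolding w_def using x pow_eq_id by simp
    have "x [^] i = x [^] (i mod 2 ^ d)" for i :: nat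
    proof (rule pow_cong[OF x])
      have "[i = i mod 2 ^ d] (mod 2 ^ d)" by (simp add: cong_def)
      then show "[i = i mod 2 ^ d] (mod ord x)" using ord_x' by (rule cong_dvd_modulus_nat)
    qed
    then have "\<exists>i < (2::nat) ^ d. g = x [^] i \<or> g = x [^] i \<otimes> y" if "g \<in> carrier G" for g
      using form[OF that] by (metis mod_less_divisor zero_less_numeral zero_less_power)
    then have sub: "carrier G \<subseteq> (\<lambda>i. x [^] i) ` {..<2 ^ d :: nat} \<union> (\<lambda>i. x [^] i \<otimes> y) ` {..<2 ^ d :: nat}"
      by blast
    have "card (carrier G) \<le> card ((\<lambda>i. x [^] i) ` {..<2 ^ d :: nat} \<union> (\<lambda>i. x [^] i \<otimes> y) ` {..<2 ^ d :: nat})"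
      by (rule card_mono[OF _ sub]) simp
    also have "\<dots> \<le> card ((\<lambda>i. x [^] i) ` {..<2 ^ d :: nat}) + card ((\<lambda>i. x [^] i \<otimes> y) ` {..<2 ^ d :: nat})"
      by (rule card_Un_le)
    also have "\<dots> \<le> 2 ^ d + 2 ^ d"
      by (intro add_mono order_trans[OF card_image_le]) simp_all
    finally show False using order d unfolding order_def by simp
  qed
  have w_pow: "\<exists>k::nat. w = g [^] k" if g: "g \<in> carrier G" "g \<noteq> \<one>" for g
  proof -
    obtain i :: nat where "g = x [^] i \<or> g = x [^] i \<otimes> y" using form g by blast
    then show ?thesis
    proof
      assume gi: "g = x [^] i"
      then have "i \<noteq> 0" using g by (intro notI) simp
      \<comment> \<open>Since \<open>x [^] i\<close> is nontrivial, the power of 2 in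
        \<open>i\<close> is at most \<open>2 ^ d\<close>. Raising to the missing power of 2 gives
        \<open>w [^] b\<close>, which is \<open>w\<close> because \<open>b\<close> is odd.\<close>
      then obtain b where b: "i = 2 ^ multiplicity 2 i * b" "odd b"
        using multiplicity_decompose'[of i 2] by (metis odd_one)
      let ?a = "multiplicity 2 i"
      have "?a \<le> d"
      proof (rule ccontr)
        assume "\<not> ?a \<le> d"
        then have "(2::nat) ^ Suc d dvd 2 ^ ?a" by (intro le_imp_power_dvd) simp
        then have "ord x dvd i" using ord_x b(1) by (metis dvd_trans dvd_mult2)
        then show False using g x gi pow_eq_id by simp
      qed
      then have "(2::nat) ^ ?a * 2 ^ (d - ?a) = 2 ^ d" by (simp flip: power_add)
      then have "i * 2 ^ (d - ?a) = 2 ^ d * b" using b(1) by (metis mult.assoc mult.commute)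
      then have "g [^] ((2::nat) ^ (d - ?a)) = w [^] b"
        unfolding gi w_def using x by (simp add: nat_pow_pow)
      also have "\<dots> = w [^] (1::nat)"
      proof (rule pow_cong[OF wG])
        have "[b = 1] (mod 2)" using b(2) by (simp add: cong_def odd_iff_mod_2_eq_one)
        then show "[b = 1] (mod ord w)"
          by (rule cong_dvd_modulus_nat) (use w_sq wG pow_eq_id in simp)
      qed
      finally show ?thesis using wG by (metis nat_pow_eone)
    next
      assume gi: "g = x [^] i \<otimes> y"
      \<comment> \<open>\<open>y\<close> inverts \<open>x\<close>, so the two factors
        \<open>x [^] i\<close> cancel and the square is that of \<open>y\<close>.\<close>
      have "g [^] (2::nat) = x [^] (i * Suc r) \<otimes> y [^] (2::nat)"
        using twist_mult_pow[OF x y twist, of i 2] gi by (simp add: numeral_2_eq_2)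
      also have "x [^] (i * Suc r) = \<one>"
        using \<open>x [^] Suc r = \<one>\<close> x by (metis mult.commute nat_pow_one nat_pow_pow)
      finally have "w = g [^] (2::nat)" using y_w wG by simp
      then show ?thesis by blast
    qed
  qed
  have "\<exists>z \<in> carrier G. \<exists>(k::nat) (l::nat). w = z [^] k \<and> u = z [^] l" if u: "u \<in> carrier G" for u
  proof (cases "u = \<one>")
    case True
    then have "w = w [^] (1::nat)" "u = w [^] (0::nat)" using wG by auto
    then show ?thesis using wG by blast
  next
    case False
    then obtain k :: nat where "w = u [^] k" using w_pow u by blast
    moreover have "u = u [^] (1::nat)" using u by simp
    ultimately show ?thesis using u by blast
  qed
  then have "is_cone_vertex G w" unfolding is_cone_vertex_iff using wG w_ne by blast
  then show ?thesis unfolding cone_property_def by blast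
qed

theorem theorem3p3:
  fixes G :: "('a, 'b) monoid_scheme" and p :: nat
  assumes "group G"
    and "finite (carrier G)"
    and "prime p"
    and "\<exists>k. order G = p ^ k"
    and "\<not> comm_group G"
  shows "cone_property G \<longleftrightarrow> generalized_quaternion G"
proof -
  interpret finite_p_group G p
    using assms by (simp add: finite_p_group_def finite_p_group_axioms_def)
  show ?thesis
  proof
    assume "cone_property G"
    then interpret p_group_unique_min G p by (rule unique_min_if_cone_property)
    show "generalized_quaternion G"
      using assms(5) by (rule generalized_quaternion_if_not_comm)
  next
    assume "generalized_quaternion G"
    then show "cone_property G" by (rule cone_property_if_generalized_quaternion)
  qed
qed

end
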